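(* There exists a combined equilibrium of business land-use, i.e. there exists $(f,x,q,d,h)\in K_1\times K_2$ such that, for all $r\in O$, $s\in D$, $k\in R_{rs}$, $$q_{rs}=O_r\frac{\exp\{-\gamma[v_{rs}-A_s(d_s,h_s)]\}}{\sum_{j\in D}\exp\{-\gamma[v_{rj}-A_j(d_j,h_j)]\}},\quad f_k^{rs}=q_{rs}\frac{\exp\{-\alpha\sum_{a\in A}\delta_{ak}^{rs}t_a(x_a)\}}{\sum_{j\in R_{rs}}\exp\{-\alpha\sum_{a\in A}\delta_{aj}^{rs}t_a(x_a)\}},\quad h_s=T\frac{\exp[\beta B_s(d_s,h_s)]}{\sum_{j\in D}\exp[\beta B_j(d_j,h_j)]},$$ where $v_{rs}=-\frac1\alpha\ln\{\sum_{j\in R_{rs}}\exp[-\alpha\sum_{a\in A}\delta_{aj}^{rs}t_a(x_a)]\}$.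
   Context: $G=(V,A)$ is a finite directed network with link set $A$, finite nonempty origin set $O$ and destination set $D$ (every destination is a business center). For $r\in O$, $s\in D$, $R_{rs}$ is the (finite, nonempty) set of simple routes from $r$ to $s$; $\delta_{ak}^{rs}=1$ if link $a$ lies on route $k\in R_{rs}$ and $0$ otherwise. $O_r>0$ is the fixed travel demand from origin $r$, and $T>0$ is the fixed total number of business companies. Variables: path flows $f=(f_k^{rs})$, link flows $x=(x_a)$, origin-destination demands $q=(q_{rs})$, destination demands $d=(d_s)$, business flows $h=(h_s)$. $$K_1=\Big\{(f,x,q,d): f_k^{rs}\ge0,\ \sum_{k\in R_{rs}}f_k^{rs}=q_{rs},\ \sum_{s\in D}q_{rs}=O_r,\ \sum_{r\in O}\sum_{s\in D}\sum_{k\in R_{rs}}\delta_{ak}^{rs}f_k^{rs}=x_a,\ \sum_{r\in O}q_{rs}=d_s\ \ \forall k\in R_{rs},r\in O,s\in D,a\in A\Big\},$$ $$K_2=\Big\{h: h_s\ge0\ \forall s\in D,\ \sum_{s\in D}h_s=T\Big\}.$$ Parameters: $\alpha,\beta,\gamma>0$ with $\alpha\ge\gamma$. Standing assumptions on functions of nonnegative real arguments: each link travel time $t_a(x_a)$ is convex, continuously differentiable and strictly increasing; each trip attraction function $A_s(d_s,h_s)$ is continuously differentiable, strictly decreasing and strictly concave in $d_s$, and strictly increasing in $h_s$; each business attraction function $B_s(d_s,h_s)$ is continuously differentiable, strictly increasing in $d_s$ and strictly decreasing in $h_s$. *)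

theory Defs
  imports "HOL-Analysis.Analysis" "Graph_Theory.Arc_Walk"
begin

(* C^1 on a set that need not be open: the derivative is taken within S, hence one-sided
   at the boundary of [0,\<infinity>) or of the closed quadrant. *)
definition C1_within :: "('a::real_normed_vector \<Rightarrow> 'b::real_normed_vector) \<Rightarrow> 'a set \<Rightarrow> bool" where
  "C1_within g S \<longleftrightarrow>
     (\<exists>g' :: 'a \<Rightarrow> 'a \<Rightarrow>\<^sub>L 'b.
        (\<forall>z\<in>S. (g has_derivative blinfun_apply (g' z)) (at z within S)) \<and> continuous_on S g')"

definition strictly_concave_on :: "'a::real_vector set \<Rightarrow> ('a \<Rightarrow> real) \<Rightarrow> bool" where
  "strictly_concave_on S g \<longleftrightarrow> convex S \<and>
     (\<forall>y\<in>S. \<forall>z\<in>S. \<forall>u\<in>{0<..<1::real}. y \<noteq> z \<longrightarrow>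
        g ((1 - u) *\<^sub>R y + u *\<^sub>R z) > (1 - u) * g y + u * g z)"

(* A route is given by its list of links; in the degenerate case r = s the only simple
   route is the empty one. *)
definition routes :: "('v, 'e) pre_digraph \<Rightarrow> 'v \<Rightarrow> 'v \<Rightarrow> 'e list set" where
  "routes G r s = {k. pre_digraph.apath G r k s}"

definition incidence :: "'e \<Rightarrow> 'e list \<Rightarrow> real" where
  "incidence a k = (if a \<in> set k then 1 else 0)"

(* Families of variables are total functions of which only the values on the relevant
   index sets matter; org and dst are the origin and destination sets, dem r is the
   demand O_r. *)
definition K1 :: "('v, 'e) pre_digraph \<Rightarrow> 'v set \<Rightarrow> 'v set \<Rightarrow> ('v \<Rightarrow> real) \<Rightarrow>
    (('v \<Rightarrow> 'v \<Rightarrow> 'e list \<Rightarrow> real) \<times> ('e \<Rightarrow> real) \<times> ('v \<Rightarrow> 'v \<Rightarrow> real) \<times> ('v \<Rightarrow> real)) set" where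
  "K1 G org dst dem = {(f, x, q, d).
     (\<forall>r\<in>org. \<forall>s\<in>dst. \<forall>k\<in>routes G r s. f r s k \<ge> 0) \<and>
     (\<forall>r\<in>org. \<forall>s\<in>dst. (\<Sum>k\<in>routes G r s. f r s k) = q r s) \<and>
     (\<forall>r\<in>org. (\<Sum>s\<in>dst. q r s) = dem r) \<and>
     (\<forall>a\<in>arcs G. (\<Sum>r\<in>org. \<Sum>s\<in>dst. \<Sum>k\<in>routes G r s. incidence a k * f r s k) = x a) \<and>
     (\<forall>s\<in>dst. (\<Sum>r\<in>org. q r s) = d s)}"

definition K2 :: "'v set \<Rightarrow> real \<Rightarrow> ('v \<Rightarrow> real) set" where
  "K2 dst T = {h. (\<forall>s\<in>dst. h s \<ge> 0) \<and> (\<Sum>s\<in>dst. h s) = T}"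

definition route_time ::
    "('v, 'e) pre_digraph \<Rightarrow> ('e \<Rightarrow> real \<Rightarrow> real) \<Rightarrow> ('e \<Rightarrow> real) \<Rightarrow> 'e list \<Rightarrow> real" where
  "route_time G t x k = (\<Sum>a\<in>arcs G. incidence a k * t a (x a))"

definition expected_cost ::
    "('v, 'e) pre_digraph \<Rightarrow> real \<Rightarrow> ('e \<Rightarrow> real \<Rightarrow> real) \<Rightarrow> ('e \<Rightarrow> real) \<Rightarrow> 'v \<Rightarrow> 'v \<Rightarrow> real" where
  "expected_cost G \<alpha> t x r s = - (1 / \<alpha>) * ln (\<Sum>j\<in>routes G r s. exp (- \<alpha> * route_time G t x j))"

end

theory Submission
  imports Defs
begin

text \<open>
Substituting the three logit formulas into one another, an equilibrium is determined by the link
flows \<open>x\<close>, destination demands \<open>d\<close> and business flows \<open>h\<close> alone: given any nonnegative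
\<open>(x, d, h)\<close>, the formulas prescribe \<open>q\<close> and then \<open>f\<close>, aggregation over routes and over origins
returns new link flows and destination demands, and the third formula returns new business flows.
An equilibrium is exactly a fixed point of this map. Logit shares lie in \<open>[0, 1]\<close> and sum to one,
so no link flow or destination demand exceeds the total demand \<open>\<Sum>r. O_r\<close> and no business flow
exceeds \<open>T\<close>; hence the map sends a compact box into itself. It is continuous, because the link
times and attraction functions are continuous for nonnegative arguments and the logit denominators
never vanish. Brouwer's theorem then gives the fixed point, and the conservation laws defining
\<open>K1\<close> and \<open>K2\<close> hold at it because shares sum to one.

The dimension of the box is the number of links plus twice the number of destinations, so it
depends on the network and cannot be the dimension of a fixed Euclidean type. For this reason
Brouwer's theorem is derived for boxes in a function space over an arbitrary finite index set
(\<open>box_fixpoint\<close>), from Kuhn's combinatorial lemma, in which the dimension is a natural number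
(\<open>unit_cube_almost_fixpoint\<close>), and compactness of the cube (\<open>unit_cube_fixpoint\<close>).
\<close>

section \<open>Brouwer's theorem over a finite index set\<close>

lemma tendsto_coordinatewise:
  fixes f :: "'a \<Rightarrow> 'i \<Rightarrow> 'b::topological_space"
  shows "(f \<longlongrightarrow> l) F \<longleftrightarrow> (\<forall>i. ((\<lambda>a. f a i) \<longlongrightarrow> l i) F)"
  using limitin_componentwise[of "\<lambda>_. euclidean :: 'b topology" UNIV f l F]
  by (simp add: euclidean_product_topology)

text \<open>
All coordinates are confined to \<open>[0, 1]\<close>, so Tychonoff's theorem applies even though only finitely
many of them will matter; countability of the index type makes the product topology first
countable, which turns compactness into sequential compactness.
\<close>
lemma seq_compact_unit_cube:
  "seq_compact {z :: nat \<Rightarrow> real. \<forall>i. z i \<in> {0..1}}"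
proof -
  have "compactin (product_topology (\<lambda>_::nat. euclidean) UNIV) (PiE UNIV (\<lambda>_. {0..1::real}))"
    by (simp add: compactin_PiE)
  moreover have "PiE UNIV (\<lambda>_. {0..1::real}) = {z :: nat \<Rightarrow> real. \<forall>i. z i \<in> {0..1}}"
    by (auto simp: PiE_iff)
  ultimately have "compact {z :: nat \<Rightarrow> real. \<forall>i. z i \<in> {0..1}}"
    by (metis compactin_euclidean_iff euclidean_product_topology)
  then show ?thesis by (rule compact_imp_seq_compact)
qed

text \<open>
Label each point of the grid of mesh \<open>1 / p\<close>, in each coordinate \<open>i\<close>, by the direction in which
\<open>F\<close> moves it. Since \<open>F\<close> maps the cube into itself, these labels satisfy the boundary conditions of
Kuhn's lemma, which yields a grid cell where both directions occur in every coordinate.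
The points \<open>u\<close> and \<open>v\<close> at which they occur depend on \<open>i\<close>; only their distance to \<open>y\<close> is
controlled, uniformly in \<open>i\<close>.
\<close>
lemma unit_cube_almost_fixpoint:
  fixes F :: "(nat \<Rightarrow> real) \<Rightarrow> nat \<Rightarrow> real" and n p :: nat
  defines "Q \<equiv> {z :: nat \<Rightarrow> real. \<forall>i. z i \<in> {0..1}}"
  assumes p: "p > 0"
    and maps: "\<And>z i. z \<in> Q \<Longrightarrow> i < n \<Longrightarrow> F z i \<in> {0..1}"
  shows "\<exists>y\<in>Q. \<forall>i<n. \<exists>u\<in>Q. \<exists>v\<in>Q. (\<forall>j. \<bar>u j - y j\<bar> \<le> 1 / p) \<and> (\<forall>j. \<bar>v j - y j\<bar> \<le> 1 / p) \<and>
           u i \<le> F u i \<and> F v i \<le> v i"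
proof -
  define g where "g x = (\<lambda>i. if i < n then real (x i) / real p else 0)" for x :: "nat \<Rightarrow> nat"
  \<comment> \<open>On the face \<open>x i = p\<close> a fixed coordinate must be labelled 1, whence the test \<open>x i < p\<close>.\<close>
  define label where "label x i = (if x i < p \<and> g x i \<le> F (g x) i then 0 else 1 :: nat)" for x i
  have gQ: "g x \<in> Q" if "\<forall>i<n. x i \<le> p" for x
    using that p by (auto simp: g_def Q_def)
  have lab1: "label x i = 0" if "\<forall>i<n. x i \<le> p" "i < n" "x i = 0" for x i
    using maps[OF gQ[OF that(1)] that(2)] that p by (simp add: label_def g_def)
  have lab2: "label x i = 1" if "x i = p" for x i
    using that by (simp add: label_def)
  obtain q where q: "\<forall>i<n. q i < p"
    and rs: "\<forall>i<n. \<exists>r s. (\<forall>j<n. q j \<le> r j \<and> r j \<le> q j + 1) \<and>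
         (\<forall>j<n. q j \<le> s j \<and> s j \<le> q j + 1) \<and> label r i \<noteq> label s i"
    by (rule kuhn_lemma[OF p, of n label]) (use lab1 lab2 in \<open>auto simp: label_def\<close>)
  have near: "\<bar>g r j - g q j\<bar> \<le> 1 / p" if "\<forall>j<n. q j \<le> r j \<and> r j \<le> q j + 1" for r j
  proof (cases "j < n")
    case True
    then have "\<bar>real (r j) - real (q j)\<bar> \<le> 1" using that by (auto simp: abs_if)
    then show ?thesis using True p
      by (simp add: g_def flip: diff_divide_distrib) (simp add: divide_right_mono)
  qed (simp add: g_def)
  have le_p: "\<forall>j<n. r j \<le> p" if "\<forall>j<n. q j \<le> r j \<and> r j \<le> q j + 1" for r
    using that q by (metis Suc_eq_plus1 Suc_leI le_trans)
  have up: "g r i \<le> F (g r) i" if "label r i = 0" for r i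
    using that by (auto simp: label_def split: if_splits)
  have down: "F (g r) i \<le> g r i" if r: "\<forall>j<n. r j \<le> p" "i < n" and 1: "label r i \<noteq> 0" for r i
  proof (cases "r i = p")
    case True
    then show ?thesis using maps[OF gQ[OF r(1)] r(2)] r p by (simp add: g_def)
  next
    case False
    then have "r i < p" using r by (simp add: order_less_le)
    then show ?thesis using 1 by (auto simp: label_def split: if_splits)
  qed
  show ?thesis
  proof (rule bexI[of _ "g q"], intro allI impI)
    fix i assume i: "i < n"
    obtain r s where r: "\<forall>j<n. q j \<le> r j \<and> r j \<le> q j + 1"
      and s: "\<forall>j<n. q j \<le> s j \<and> s j \<le> q j + 1" and ne: "label r i \<noteq> label s i"
      using rs i by blast
    consider "label r i = 0" "label s i \<noteq> 0" | "label s i = 0" "label r i \<noteq> 0"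
      using ne by (auto simp: label_def split: if_splits)
    then show "\<exists>u\<in>Q. \<exists>v\<in>Q. (\<forall>j. \<bar>u j - g q j\<bar> \<le> 1 / p) \<and> (\<forall>j. \<bar>v j - g q j\<bar> \<le> 1 / p) \<and>
           u i \<le> F u i \<and> F v i \<le> v i"
    proof cases
      case 1
      then show ?thesis using near r s up down le_p gQ i
        by (intro bexI[of _ "g r"] bexI[of _ "g s"]) auto
    next
      case 2
      then show ?thesis using near r s up down le_p gQ i
        by (intro bexI[of _ "g s"] bexI[of _ "g r"]) auto
    qed
  qed (use q gQ in \<open>auto simp: less_imp_le\<close>)
qed

text \<open>
As the mesh tends to zero, the almost fixed points accumulate at some \<open>z\<close>. In each coordinate the
two witnesses of opposite direction converge to the same \<open>z\<close>, and continuity turns the two opposite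
inequalities into an equality.
\<close>
lemma unit_cube_fixpoint:
  fixes F :: "(nat \<Rightarrow> real) \<Rightarrow> nat \<Rightarrow> real" and n :: nat
  defines "Q \<equiv> {z :: nat \<Rightarrow> real. \<forall>i. z i \<in> {0..1}}"
  assumes maps: "\<And>z i. z \<in> Q \<Longrightarrow> i < n \<Longrightarrow> F z i \<in> {0..1}"
    and cont: "\<And>i. i < n \<Longrightarrow> continuous_on Q (\<lambda>z. F z i)"
  shows "\<exists>z\<in>Q. \<forall>i<n. F z i = z i"
proof -
  have "\<forall>m. \<exists>y. y \<in> Q \<and> (\<forall>i<n. \<exists>u\<in>Q. \<exists>v\<in>Q. (\<forall>j. \<bar>u j - y j\<bar> \<le> 1 / Suc m) \<and>
          (\<forall>j. \<bar>v j - y j\<bar> \<le> 1 / Suc m) \<and> u i \<le> F u i \<and> F v i \<le> v i)"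
    using unit_cube_almost_fixpoint[of _ n F, folded Q_def, OF _ maps] by blast
  from choice[OF this] obtain y where y: "\<forall>m. y m \<in> Q \<and>
      (\<forall>i<n. \<exists>u\<in>Q. \<exists>v\<in>Q. (\<forall>j. \<bar>u j - y m j\<bar> \<le> 1 / Suc m) \<and>
        (\<forall>j. \<bar>v j - y m j\<bar> \<le> 1 / Suc m) \<and> u i \<le> F u i \<and> F v i \<le> v i)" ..
  then have yQ: "y m \<in> Q" for m by blast
  define P where "P m i u v \<longleftrightarrow> u \<in> Q \<and> v \<in> Q \<and>
      (\<forall>j. \<bar>u j - y m j\<bar> \<le> 1 / Suc m) \<and> (\<forall>j. \<bar>v j - y m j\<bar> \<le> 1 / Suc m) \<and>
      u i \<le> F u i \<and> F v i \<le> v i" for m i u v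
  have "\<forall>m i. \<exists>u v. i < n \<longrightarrow> P m i u v"
    unfolding P_def using y by blast
  then obtain u v where "\<And>m i. i < n \<Longrightarrow> P m i (u m i) (v m i)"
    by metis
  note uv = this[unfolded P_def]
  obtain z \<phi> where zQ: "z \<in> Q" and \<phi>: "strict_mono \<phi>" and lim: "(y \<circ> \<phi>) \<longlonglongrightarrow> z"
    using seq_compactE[OF seq_compact_unit_cube, folded Q_def, of y] yQ by blast
  have lim_near: "(\<lambda>m. w (\<phi> m)) \<longlonglongrightarrow> z" if w: "\<And>m j. \<bar>w m j - y m j\<bar> \<le> 1 / Suc m"
    for w :: "nat \<Rightarrow> nat \<Rightarrow> real"
    unfolding tendsto_coordinatewise
  proof
    fix j
    have "(\<lambda>m. 1 / real (Suc m)) \<longlonglongrightarrow> 0"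
      using LIMSEQ_inverse_real_of_nat by (simp add: inverse_eq_divide)
    then have "(\<lambda>m. w m j - y m j) \<longlonglongrightarrow> 0"
      by (rule Lim_null_comparison[rotated]) (use w in auto)
    then have 1: "(\<lambda>m. w (\<phi> m) j - y (\<phi> m) j) \<longlonglongrightarrow> 0"
      using LIMSEQ_subseq_LIMSEQ[OF _ \<phi>] by (force simp: o_def)
    have 2: "(\<lambda>m. y (\<phi> m) j) \<longlonglongrightarrow> z j"
      using lim by (simp add: tendsto_coordinatewise o_def)
    show "(\<lambda>m. w (\<phi> m) j) \<longlonglongrightarrow> z j"
      using tendsto_add[OF 1 2] by simp
  qed
  have lim_F: "(\<lambda>m. F (w (\<phi> m)) i) \<longlonglongrightarrow> F z i"
    if "i < n" "\<And>m. w m \<in> Q" "(\<lambda>m. w (\<phi> m)) \<longlonglongrightarrow> z" for w i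
    using cont[OF that(1)] zQ that unfolding continuous_on_sequentially by (auto simp: o_def)
  have "F z i = z i" if i: "i < n" for i
  proof (rule antisym)
    have U: "(\<lambda>m. u (\<phi> m) i) \<longlonglongrightarrow> z" and V: "(\<lambda>m. v (\<phi> m) i) \<longlonglongrightarrow> z"
      using lim_near[of "\<lambda>m. u m i"] lim_near[of "\<lambda>m. v m i"] uv[OF i] by auto
    have "(\<lambda>m. u (\<phi> m) i i) \<longlonglongrightarrow> z i" "(\<lambda>m. F (u (\<phi> m) i) i) \<longlonglongrightarrow> F z i"
      using U lim_F[of i "\<lambda>m. u m i"] i uv[OF i] by (auto simp: tendsto_coordinatewise)
    then show "z i \<le> F z i" by (rule LIMSEQ_le) (use uv[OF i] in auto)
    have "(\<lambda>m. F (v (\<phi> m) i) i) \<longlonglongrightarrow> F z i" "(\<lambda>m. v (\<phi> m) i i) \<longlonglongrightarrow> z i"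
      using V lim_F[of i "\<lambda>m. v m i"] i uv[OF i] by (auto simp: tendsto_coordinatewise)
    then show "F z i \<le> z i" by (rule LIMSEQ_le) (use uv[OF i] in auto)
  qed
  then show ?thesis using zQ by blast
qed

text \<open>
The index set is enumerated by an initial segment of the natural numbers and each side of the box
rescaled to \<open>[0, 1]\<close>. Degenerate sides \<open>c i = 0\<close> are harmless: there \<open>F z i = 0\<close> is forced,
whatever value division by zero gives in the rescaled map.
\<close>
lemma box_fixpoint:
  fixes F :: "('i \<Rightarrow> real) \<Rightarrow> 'i \<Rightarrow> real" and c :: "'i \<Rightarrow> real"
  defines "S \<equiv> {z :: 'i \<Rightarrow> real. \<forall>i. z i \<in> {0..c i}}"
  assumes I: "finite I" and c: "\<And>i. c i \<ge> 0"
    and maps: "\<And>z i. z \<in> S \<Longrightarrow> i \<in> I \<Longrightarrow> F z i \<in> {0..c i}"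
    and cont: "\<And>i. i \<in> I \<Longrightarrow> continuous_on S (\<lambda>z. F z i)"
  shows "\<exists>z\<in>S. \<forall>i\<in>I. F z i = z i"
proof -
  obtain e where e: "bij_betw e {0..<card I} I" using ex_bij_betw_nat_finite[OF I] by blast
  define n where "n = card I"
  define idx where "idx = the_inv_into {0..<n} e"
  have idx: "idx (e j) = j" if "j < n" for j
    using that e by (auto simp: idx_def n_def bij_betw_def the_inv_into_f_f)
  have eI: "e j \<in> I" if "j < n" for j
    using that e by (auto simp: n_def bij_betw_def)
  have Ie: "\<exists>j<n. i = e j" if "i \<in> I" for i
    using that bij_betw_imp_surj_on[OF e] by (force simp: n_def)
  define Q where "Q = {z :: nat \<Rightarrow> real. \<forall>i. z i \<in> {0..1}}"
  define scale where "scale y = (\<lambda>i. c i * y (idx i))" for y :: "nat \<Rightarrow> real"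
  have scaleS: "scale y \<in> S" if "y \<in> Q" for y
    using that c by (auto simp: Q_def S_def scale_def mult_left_le)
  have scale_cont: "continuous_on Q scale"
    unfolding scale_def by (intro continuous_intros continuous_on_subset[OF continuous_on_product_coordinates]) auto
  have "\<exists>y\<in>Q. \<forall>j<n. F (scale y) (e j) / c (e j) = y j"
    unfolding Q_def
  proof (rule unit_cube_fixpoint, fold Q_def)
    fix y j assume y: "y \<in> Q" and j: "j < n"
    show "F (scale y) (e j) / c (e j) \<in> {0..1}"
      using maps[OF scaleS[OF y] eI[OF j]] c[of "e j"] by (auto simp: divide_le_eq_1)
  next
    fix j assume j: "j < n"
    have "continuous_on Q (\<lambda>y. F (scale y) (e j))"
      by (rule continuous_on_compose2[OF cont[OF eI[OF j]] scale_cont]) (use scaleS in auto)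
    then show "continuous_on Q (\<lambda>y. F (scale y) (e j) / c (e j))"
      unfolding divide_inverse by (intro continuous_intros)
  qed
  then obtain y where y: "y \<in> Q" and fix_y: "\<And>j. j < n \<Longrightarrow> F (scale y) (e j) / c (e j) = y j"
    by blast
  have "F (scale y) i = scale y i" if i: "i \<in> I" for i
  proof -
    obtain j where j: "j < n" "i = e j" using Ie[OF i] by blast
    show ?thesis
      using fix_y[OF j(1)] maps[OF scaleS[OF y] i] j
      by (cases "c i = 0") (auto simp: scale_def idx field_simps)
  qed
  then show ?thesis using scaleS[OF y] by blast
qed

section \<open>Logit shares\<close>

definition logit :: "'k set \<Rightarrow> ('k \<Rightarrow> real) \<Rightarrow> 'k \<Rightarrow> real" where
  "logit K w k = exp (w k) / (\<Sum>j\<in>K. exp (w j))"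

lemma sum_exp_pos: "finite K \<Longrightarrow> K \<noteq> {} \<Longrightarrow> (\<Sum>j\<in>K. exp (w j :: real)) > 0"
  by (simp add: sum_pos)

lemma logit_nonneg: "logit K w k \<ge> 0"
  by (simp add: logit_def sum_nonneg)

lemma sum_logit: "finite K \<Longrightarrow> K \<noteq> {} \<Longrightarrow> (\<Sum>k\<in>K. logit K w k) = 1"
  using sum_exp_pos[of K w] by (simp add: logit_def flip: sum_divide_distrib)

lemma logit_le_1:
  assumes "finite K" "k \<in> K"
  shows "logit K w k \<le> 1"
proof -
  have "logit K w k \<le> (\<Sum>k\<in>K. logit K w k)"
    by (rule member_le_sum) (simp_all add: assms logit_nonneg)
  also have "\<dots> = 1"
    by (rule sum_logit) (use assms in auto)
  finally show ?thesis .
qed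

lemma continuous_on_logit:
  assumes "finite K" "k \<in> K" "\<And>j. j \<in> K \<Longrightarrow> continuous_on S (\<lambda>z. w z j)"
  shows "continuous_on S (\<lambda>z. logit K (w z) k)"
  unfolding logit_def
  using sum_exp_pos[of K] assms
  by (intro continuous_intros assms) (auto simp: less_le)

lemma C1_within_imp_continuous_on: "C1_within g S \<Longrightarrow> continuous_on S g"
  unfolding C1_within_def continuous_on_eq_continuous_within
  using has_derivative_continuous by blast

section \<open>The equilibrium as a fixed point\<close>

theorem mainTheorem5:
  fixes G :: "('v, 'e) pre_digraph"
    and org dst :: "'v set"
    and dem :: "'v \<Rightarrow> real"
    and T \<alpha> \<beta> \<gamma> :: real
    and t :: "'e \<Rightarrow> real \<Rightarrow> real"
    and A B :: "'v \<Rightarrow> real \<Rightarrow> real \<Rightarrow> real"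
  assumes network: "fin_digraph G"
    and origins: "org \<subseteq> verts G" "finite org" "org \<noteq> {}"
    and destinations: "dst \<subseteq> verts G" "finite dst" "dst \<noteq> {}"
    and connected: "\<And>r s. r \<in> org \<Longrightarrow> s \<in> dst \<Longrightarrow> routes G r s \<noteq> {}"
    and demand_pos: "\<And>r. r \<in> org \<Longrightarrow> dem r > 0"
    and T_pos: "T > 0"
    and parameters: "\<alpha> > 0" "\<beta> > 0" "\<gamma> > 0" "\<alpha> \<ge> \<gamma>"
    and t_convex: "\<And>a. a \<in> arcs G \<Longrightarrow> convex_on {0..} (t a)"
    and t_C1: "\<And>a. a \<in> arcs G \<Longrightarrow> C1_within (t a) {0..}"
    and t_increasing: "\<And>a. a \<in> arcs G \<Longrightarrow> strict_mono_on {0..} (t a)"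
    and A_C1: "\<And>s. s \<in> dst \<Longrightarrow> C1_within (\<lambda>(d, h). A s d h) ({0..} \<times> {0..})"
    and A_decreasing: "\<And>s h. s \<in> dst \<Longrightarrow> h \<ge> 0 \<Longrightarrow> strict_antimono_on {0..} (\<lambda>d. A s d h)"
    and A_concave: "\<And>s h. s \<in> dst \<Longrightarrow> h \<ge> 0 \<Longrightarrow> strictly_concave_on {0..} (\<lambda>d. A s d h)"
    and A_increasing: "\<And>s d. s \<in> dst \<Longrightarrow> d \<ge> 0 \<Longrightarrow> strict_mono_on {0..} (\<lambda>h. A s d h)"
    and B_C1: "\<And>s. s \<in> dst \<Longrightarrow> C1_within (\<lambda>(d, h). B s d h) ({0..} \<times> {0..})"
    and B_increasing: "\<And>s h. s \<in> dst \<Longrightarrow> h \<ge> 0 \<Longrightarrow> strict_mono_on {0..} (\<lambda>d. B s d h)"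
    and B_decreasing: "\<And>s d. s \<in> dst \<Longrightarrow> d \<ge> 0 \<Longrightarrow> strict_antimono_on {0..} (\<lambda>h. B s d h)"
  shows "\<exists>f x q d h. ((f, x, q, d), h) \<in> K1 G org dst dem \<times> K2 dst T \<and>
    (\<forall>r\<in>org. \<forall>s\<in>dst. \<forall>k\<in>routes G r s.
       q r s = dem r * (exp (- \<gamma> * (expected_cost G \<alpha> t x r s - A s (d s) (h s))) /
         (\<Sum>j\<in>dst. exp (- \<gamma> * (expected_cost G \<alpha> t x r j - A j (d j) (h j))))) \<and>
       f r s k = q r s * (exp (- \<alpha> * route_time G t x k) /
         (\<Sum>j\<in>routes G r s. exp (- \<alpha> * route_time G t x j))) \<and>
       h s = T * (exp (\<beta> * B s (d s) (h s)) /
         (\<Sum>j\<in>dst. exp (\<beta> * B j (d j) (h j)))))"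
proof -
  interpret fin_digraph G by (rule network)
  have fin_routes: "finite (routes G r s)" for r s
    unfolding routes_def by (rule apaths_finite)
  have cont_t: "continuous_on {0..} (t a)" if "a \<in> arcs G" for a
    using C1_within_imp_continuous_on t_C1 that by blast
  have cont_A: "continuous_on ({0..} \<times> {0..}) (\<lambda>(d, h). A s d h)"
    and cont_B: "continuous_on ({0..} \<times> {0..}) (\<lambda>(d, h). B s d h)" if "s \<in> dst" for s
    using C1_within_imp_continuous_on A_C1 B_C1 that by blast+

  define M where "M = (\<Sum>r\<in>org. dem r)"
  have dem: "dem r \<ge> 0" if "r \<in> org" for r using demand_pos[OF that] by simp
  have M: "M \<ge> 0" unfolding M_def by (intro sum_nonneg dem)

  \<comment> \<open>A point of the box lists link flows, destination demands and business flows, in this order.\<close>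
  define X D H where "X = (\<lambda>(z :: 'e + 'v + 'v \<Rightarrow> real) a. z (Inl a))"
    and "D = (\<lambda>(z :: 'e + 'v + 'v \<Rightarrow> real) s. z (Inr (Inl s)))"
    and "H = (\<lambda>(z :: 'e + 'v + 'v \<Rightarrow> real) s. z (Inr (Inr s)))"
  define q where "q z r s = dem r *
      logit dst (\<lambda>j. - \<gamma> * (expected_cost G \<alpha> t (X z) r j - A j (D z j) (H z j))) s" for z r s
  define f where "f z r s k = q z r s *
      logit (routes G r s) (\<lambda>k. - \<alpha> * route_time G t (X z) k) k" for z r s k
  define \<Phi> where "\<Phi> z = case_sum
      (\<lambda>a. \<Sum>r\<in>org. \<Sum>s\<in>dst. \<Sum>k\<in>routes G r s. incidence a k * f z r s k)
      (case_sum (\<lambda>s. \<Sum>r\<in>org. q z r s)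
                (\<lambda>s. T * logit dst (\<lambda>j. \<beta> * B j (D z j) (H z j)) s))" for z
  define c where "c = case_sum (\<lambda>_::'e. M) (case_sum (\<lambda>_::'v. M) (\<lambda>_::'v. T))"
  define S where "S = {z. \<forall>i. z i \<in> {0..c i}}"

  have q_nonneg: "q z r s \<ge> 0" if "r \<in> org" for z r s
    unfolding q_def by (intro mult_nonneg_nonneg dem logit_nonneg that)
  have f_nonneg: "f z r s k \<ge> 0" if "r \<in> org" for z r s k
    unfolding f_def by (intro mult_nonneg_nonneg q_nonneg logit_nonneg that)
  have sum_q: "(\<Sum>s\<in>dst. q z r s) = dem r" for z r
    unfolding q_def using sum_logit[OF destinations(2,3)] by (simp flip: sum_distrib_left)
  have sum_f: "(\<Sum>k\<in>routes G r s. f z r s k) = q z r s" if "r \<in> org" "s \<in> dst" for z r s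
    unfolding f_def using sum_logit[OF fin_routes connected[OF that]]
    by (simp flip: sum_distrib_left)

  have "\<exists>z\<in>S. \<forall>i \<in> arcs G <+> (dst <+> dst). \<Phi> z i = z i"
    unfolding S_def
  proof (rule box_fixpoint, fold S_def)
    show "finite (arcs G <+> (dst <+> dst))" using destinations by simp
    show "c i \<ge> 0" for i
      using M T_pos by (auto simp: c_def split: sum.splits)
  next
    fix z i assume i: "i \<in> arcs G <+> (dst <+> dst)"
    have "0 \<le> (\<Sum>r\<in>org. \<Sum>s\<in>dst. \<Sum>k\<in>routes G r s. incidence a k * f z r s k)" for a
      by (intro sum_nonneg) (auto simp: incidence_def f_nonneg)
    moreover have "(\<Sum>r\<in>org. \<Sum>s\<in>dst. \<Sum>k\<in>routes G r s. incidence a k * f z r s k) \<le> M" for a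
    proof -
      \<comment> \<open>A route uses a link at most once, so a link carries at most the total demand.\<close>
      have "(\<Sum>r\<in>org. \<Sum>s\<in>dst. \<Sum>k\<in>routes G r s. incidence a k * f z r s k)
            \<le> (\<Sum>r\<in>org. \<Sum>s\<in>dst. \<Sum>k\<in>routes G r s. f z r s k)"
        by (intro sum_mono) (auto simp: incidence_def f_nonneg)
      also have "\<dots> = M" by (simp add: sum_f sum_q M_def)
      finally show ?thesis .
    qed
    moreover have "0 \<le> (\<Sum>r\<in>org. q z r s)" for s
      by (intro sum_nonneg q_nonneg)
    moreover have "(\<Sum>r\<in>org. q z r s) \<le> M" if "s \<in> dst" for s
      unfolding M_def sum_q[of z, symmetric]
      by (intro sum_mono member_le_sum q_nonneg that destinations)
    moreover have "0 \<le> T * logit dst w s" for w s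
      using T_pos by (simp add: logit_nonneg)
    moreover have "T * logit dst w s \<le> T" if "s \<in> dst" for w s
      using T_pos logit_le_1[OF destinations(2) that, of w] by (simp add: mult_left_le)
    ultimately show "\<Phi> z i \<in> {0..c i}"
      using i by (auto simp: \<Phi>_def c_def)
  next
    fix i assume i: "i \<in> arcs G <+> (dst <+> dst)"
    have coord: "continuous_on S (\<lambda>z. z j)" for j
      by (rule continuous_on_subset[OF continuous_on_product_coordinates]) simp
    have nonneg: "z j \<ge> 0" if "z \<in> S" for z j using that by (simp add: S_def)
    have "continuous_on S (\<lambda>z. t a (X z a))" if "a \<in> arcs G" for a
      unfolding X_def
      by (rule continuous_on_compose2[OF cont_t[OF that] coord]) (use nonneg in auto)
    then have cont_time: "continuous_on S (\<lambda>z. route_time G t (X z) k)" for k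
      unfolding route_time_def by (intro continuous_intros)
    have cont_cost: "continuous_on S (\<lambda>z. expected_cost G \<alpha> t (X z) r s)"
      if "r \<in> org" "s \<in> dst" for r s
      unfolding expected_cost_def
      using sum_exp_pos[OF fin_routes connected[OF that]]
      by (intro continuous_intros cont_time) (auto simp: less_le)
    have cont_A': "continuous_on S (\<lambda>z. A s (D z s) (H z s))" if "s \<in> dst" for s
      using continuous_on_compose2[OF cont_A[OF that] continuous_on_Pair[OF coord coord]] nonneg
      by (force simp: D_def H_def)
    have cont_B': "continuous_on S (\<lambda>z. B s (D z s) (H z s))" if "s \<in> dst" for s
      using continuous_on_compose2[OF cont_B[OF that] continuous_on_Pair[OF coord coord]] nonneg
      by (force simp: D_def H_def)
    have cont_q: "continuous_on S (\<lambda>z. q z r s)" if "r \<in> org" "s \<in> dst" for r s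
      unfolding q_def
      by (intro continuous_intros continuous_on_logit cont_cost cont_A' destinations that)
    have cont_f: "continuous_on S (\<lambda>z. f z r s k)"
      if "r \<in> org" "s \<in> dst" "k \<in> routes G r s" for r s k
      unfolding f_def
      by (intro continuous_intros continuous_on_logit cont_q cont_time fin_routes that)
    consider (x) a where "i = Inl a" "a \<in> arcs G" | (d) s where "i = Inr (Inl s)" "s \<in> dst"
      | (h) s where "i = Inr (Inr s)" "s \<in> dst"
      using i by blast
    then show "continuous_on S (\<lambda>z. \<Phi> z i)"
    proof cases
      case x
      then show ?thesis by (simp add: \<Phi>_def) (intro continuous_intros cont_f)
    next
      case d
      then show ?thesis by (simp add: \<Phi>_def) (intro continuous_intros cont_q)
    next
      case h
      then show ?thesis
        by (simp add: \<Phi>_def)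
          (intro continuous_intros continuous_on_logit cont_B' destinations)
    qed
  qed
  then obtain z where fixpoint: "\<And>i. i \<in> arcs G <+> (dst <+> dst) \<Longrightarrow> \<Phi> z i = z i"
    by blast
  have X: "(\<Sum>r\<in>org. \<Sum>s\<in>dst. \<Sum>k\<in>routes G r s. incidence a k * f z r s k) = X z a"
    if "a \<in> arcs G" for a
    using fixpoint[OF InlI[OF that]] by (simp add: \<Phi>_def X_def)
  have D: "(\<Sum>r\<in>org. q z r s) = D z s" if "s \<in> dst" for s
    using fixpoint[OF InrI[OF InlI[OF that]]] by (simp add: \<Phi>_def D_def)
  have H: "H z s = T * logit dst (\<lambda>j. \<beta> * B j (D z j) (H z j)) s" if "s \<in> dst" for s
    using fixpoint[OF InrI[OF InrI[OF that]]] by (simp add: \<Phi>_def H_def)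
  have "(f z, X z, q z, D z) \<in> K1 G org dst dem"
    unfolding K1_def using f_nonneg sum_f sum_q X D by simp
  moreover have "H z \<in> K2 dst T"
  proof -
    define w where "w = (\<lambda>j. \<beta> * B j (D z j) (H z j))"
    have Hw: "H z s = T * logit dst w s" if "s \<in> dst" for s
      unfolding w_def by (rule H[OF that])
    have "(\<Sum>s\<in>dst. H z s) = T * (\<Sum>s\<in>dst. logit dst w s)"
      by (simp add: Hw sum_distrib_left)
    then show ?thesis
      unfolding K2_def using Hw T_pos by (simp add: sum_logit[OF destinations(2,3)] logit_nonneg)
  qed
  ultimately have "((f z, X z, q z, D z), H z) \<in> K1 G org dst dem \<times> K2 dst T" by simp
  then show ?thesis
    by (intro exI conjI ballI) (assumption, rule q_def[unfolded logit_def],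
        rule f_def[unfolded logit_def], rule H[unfolded logit_def])
qed

end
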